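(* Let $0<q<1$, let $x,y,z\in\mathbb{C}$ with $|x|,|y|,|z|<1$, and let $\alpha_1,\alpha_2,\beta_1,\beta_2,\gamma_1,\gamma_2,\gamma_3,\eta_1,\eta_2,\nu_1,\nu_2,\nu_3\in\mathbb{C}$ satisfy $\min\{\Re(\gamma_1+\eta_1-\alpha_1-\nu_1),\Re(\alpha_1),\Re(\nu_1)\}>0$, $\min\{\Re(\gamma_2+\eta_2-\beta_2-\nu_2),\Re(\beta_2),\Re(\nu_2)\}>0$, $\Re(\gamma_3)>\Re(\nu_3)>0$, and $q^{\gamma_i},q^{\eta_i}\notin\{q^{-n}:n\in\mathbb{Z}_{\ge0}\}$ for $i=1,2$. Then \begin{align*} &\widetilde{\Phi}_K[\alpha_1,\alpha_2,\alpha_2,\beta_1,\beta_2,\beta_1;\gamma_1,\gamma_2,\gamma_3;q,x,y,z]\\ &=\int_{[0,1]^3}\widetilde{\Phi}_K[\eta_1,\alpha_2,\alpha_2,\beta_1,\eta_2,\beta_1;\nu_1,\nu_2,\nu_3;q,xt_1,yt_2,zt_3]\\ &\quad\cdot\mathrm{d}\mu_{\eta_1-\alpha_1,\;\gamma_1-\alpha_1,\;\gamma_1-\alpha_1+\eta_1-\nu_1,\;\nu_1}(t_1;q)\,\mathrm{d}\mu_{\eta_2-\beta_2,\;\gamma_2-\beta_2,\;\gamma_2-\beta_2+\eta_2-\nu_2,\;\nu_2}(t_2;q)\,\mathrm{d}\mu_{\nu_3,\;\gamma_3-\nu_3}(t_3;q). \end{align*}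
   Context: $(a;q)_n=\prod_{j=0}^{n-1}(1-aq^j)$, $(a;q)_\infty=\prod_{j\ge0}(1-aq^j)$, $(a_1,\dots,a_m;q)_n=(a_1;q)_n\cdots(a_m;q)_n$. The $k$-dimensional $q$-integral is $\int_{[0,1]^k}f(\mathbf{x})\,\mathrm{d}_q\mathbf{x}=(1-q)^k\sum_{n_1,\dots,n_k\ge0}f(q^{n_1},\dots,q^{n_k})q^{n_1+\cdots+n_k}$. $\Gamma_q(x)=\frac{(q;q)_\infty}{(q^x;q)_\infty}(1-q)^{1-x}$. The $q$-analogue of Saran's function $F_K$ is \[ \widetilde{\Phi}_K[\alpha_1,\alpha_2,\alpha_2,\beta_1,\beta_2,\beta_1;\gamma_1,\gamma_2,\gamma_3;q,x,y,z]=\sum_{m,n,p=0}^{\infty}\frac{(q^{\alpha_1};q)_m(q^{\alpha_2};q)_{n+p}(q^{\beta_1};q)_{m+p}(q^{\beta_2};q)_n}{(q^{\gamma_1},q;q)_m(q^{\gamma_2},q;q)_n(q^{\gamma_3},q;q)_p}x^my^nz^p\quad(|x|,|y|,|z|<1). \] The basic hypergeometric series is ${}_{r}\phi_{s}\left[\begin{matrix}a_1,\cdots,a_r\\ b_1,\cdots,b_s\end{matrix};q,z\right]=\sum_{n\ge0}\frac{(a_1,\cdots,a_r;q)_n}{(b_1,\cdots,b_s,q;q)_n}\big((-1)^nq^{\binom n2}\big)^{1+s-r}z^n$. The $q$-Dirichlet measure is, for $\min\{\Re(\alpha),\Re(\beta)\}>0$, \[ \mathrm{d}\mu_{\alpha,\beta}(t;q)=\frac{\Gamma_q(\alpha+\beta)}{\Gamma_q(\alpha)\Gamma_q(\beta)}t^{\alpha-1}\frac{(tq;q)_\infty}{(tq^\beta;q)_\infty}\,\mathrm{d}_qt,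 \] and the $q$-hypergeometric measure is, for $\min\{\Re(\eta),\Re(\gamma),\Re(\eta+\gamma-\alpha-\beta)\}>0$, \[ \mathrm{d}\mu_{\alpha,\beta,\gamma,\eta}(t;q)=\frac{\Gamma_q(\eta+\gamma-\alpha)\Gamma_q(\eta+\gamma-\beta)}{\Gamma_q(\eta)\Gamma_q(\gamma)\Gamma_q(\eta+\gamma-\alpha-\beta)}\,t^{\eta-1}\frac{(tq;q)_\infty}{(tq^{\gamma};q)_\infty}\,{}_{3}\phi_{1}\left[\begin{matrix}q^{\alpha},q^{\beta},t^{-1}\\ q^{\gamma}\end{matrix};q,tq^{\gamma-\alpha-\beta}\right]\mathrm{d}_qt \] (at the points $t=q^n$, $n\ge0$, the ${}_3\phi_1$ terminates). *)

theory Defs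
  imports "HOL-Analysis.Analysis"
begin

definition qpoch :: "complex \<Rightarrow> real \<Rightarrow> nat \<Rightarrow> complex" where
  "qpoch a q n = (\<Prod>j<n. 1 - a * complex_of_real q ^ j)"

definition qpochs :: "complex list \<Rightarrow> real \<Rightarrow> nat \<Rightarrow> complex" where
  "qpochs as q n = (\<Prod>a\<leftarrow>as. qpoch a q n)"

definition qpoch_inf :: "complex \<Rightarrow> real \<Rightarrow> complex" where
  "qpoch_inf a q = (\<Prod>j. 1 - a * complex_of_real q ^ j)"

definition qpow :: "real \<Rightarrow> complex \<Rightarrow> complex" where
  "qpow q a = complex_of_real q powr a"

definition qGamma :: "real \<Rightarrow> complex \<Rightarrow> complex" where
  "qGamma q x = qpoch_inf (complex_of_real q) q / qpoch_inf (qpow q x) q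
                  * complex_of_real (1 - q) powr (1 - x)"

text \<open>The basic hypergeometric series with numerator parameters \<open>as\<close> (r of them) and
  denominator parameters \<open>bs\<close> (s of them); the exponent 1 + s - r may be negative.\<close>

definition basic_hyp ::
  "complex list \<Rightarrow> complex list \<Rightarrow> real \<Rightarrow> complex \<Rightarrow> complex" where
  "basic_hyp as bs q z =
     (\<Sum>n. qpochs as q n / qpochs (bs @ [complex_of_real q]) q n
          * ((-1) ^ n * complex_of_real q ^ (n choose 2))
              powi (1 + int (length bs) - int (length as))
          * z ^ n)"

text \<open>The q-analogue of Saran's function, with bracket
  [a1, a2, a2, b1, b2, b1; c1, c2, c3; q, x, y, z]; the repeated parameters are listed once.\<close>

definition saran_K ::
  "complex \<Rightarrow> complex \<Rightarrow> complex \<Rightarrow> complex \<Rightarrow> complex \<Rightarrow> complex \<Rightarrow> complex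
     \<Rightarrow> real \<Rightarrow> complex \<Rightarrow> complex \<Rightarrow> complex \<Rightarrow> complex" where
  "saran_K a1 a2 b1 b2 c1 c2 c3 q x y z =
     (\<Sum>\<^sub>\<infinity>(m, n, p)\<in>UNIV.
        qpoch (qpow q a1) q m * qpoch (qpow q a2) q (n + p)
          * qpoch (qpow q b1) q (m + p) * qpoch (qpow q b2) q n
        / (qpochs [qpow q c1, complex_of_real q] q m
           * qpochs [qpow q c2, complex_of_real q] q n
           * qpochs [qpow q c3, complex_of_real q] q p)
        * x ^ m * y ^ n * z ^ p)"

text \<open>The q-integral over the unit cube of dimension \<open>CARD('k)\<close>, an absolutely convergent
  sum over all exponent vectors.\<close>

definition q_integral_term ::
  "real \<Rightarrow> (real ^ 'k \<Rightarrow> complex) \<Rightarrow> nat ^ 'k \<Rightarrow> complex" where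
  "q_integral_term q f n =
     f (\<chi> i. q ^ (n $ i)) * complex_of_real q ^ (\<Sum>i\<in>UNIV. n $ i)"

definition q_integrable :: "real \<Rightarrow> (real ^ 'k \<Rightarrow> complex) \<Rightarrow> bool" where
  "q_integrable q f \<longleftrightarrow> q_integral_term q f summable_on UNIV"

definition q_integral :: "real \<Rightarrow> (real ^ 'k \<Rightarrow> complex) \<Rightarrow> complex" where
  "q_integral q f =
     complex_of_real (1 - q) ^ CARD('k) * (\<Sum>\<^sub>\<infinity>n\<in>UNIV. q_integral_term q f n)"

text \<open>Both measures are given by their densities with respect to the q-integral.\<close>

definition q_dirichlet_density :: "complex \<Rightarrow> complex \<Rightarrow> real \<Rightarrow> real \<Rightarrow> complex" where
  "q_dirichlet_density \<alpha> \<beta> q t =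
     qGamma q (\<alpha> + \<beta>) / (qGamma q \<alpha> * qGamma q \<beta>)
     * complex_of_real t powr (\<alpha> - 1)
     * (qpoch_inf (complex_of_real (t * q)) q / qpoch_inf (complex_of_real t * qpow q \<beta>) q)"

definition q_hypergeometric_density ::
  "complex \<Rightarrow> complex \<Rightarrow> complex \<Rightarrow> complex \<Rightarrow> real \<Rightarrow> real \<Rightarrow> complex" where
  "q_hypergeometric_density \<alpha> \<beta> \<gamma> \<eta> q t =
     qGamma q (\<eta> + \<gamma> - \<alpha>) * qGamma q (\<eta> + \<gamma> - \<beta>)
       / (qGamma q \<eta> * qGamma q \<gamma> * qGamma q (\<eta> + \<gamma> - \<alpha> - \<beta>))
     * complex_of_real t powr (\<eta> - 1)
     * (qpoch_inf (complex_of_real (t * q)) q / qpoch_inf (complex_of_real t * qpow q \<gamma>) q)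
     * basic_hyp [qpow q \<alpha>, qpow q \<beta>, complex_of_real (inverse t)] [qpow q \<gamma>] q
         (complex_of_real t * qpow q (\<gamma> - \<alpha> - \<beta>))"

end

theory Submission
  imports Defs
begin

text \<open>
  At \<open>t = q\<^sup>n\<close> the terminating \<open>\<^sub>3\<phi>\<^sub>1\<close> turns the q-hypergeometric density into a convolution. Summing
  it against \<open>t\<^sup>m\<close>, the inner sum is a q-binomial series and the outer one a q-Gauss series, so that
  the \<open>m\<close>-th moment is
  \<open>(q\<^sup>\<eta>)\<^sub>m (q\<^bsup>\<eta>+\<gamma>-\<alpha>-\<beta>\<^esup>)\<^sub>m / ((q\<^bsup>\<eta>+\<gamma>-\<alpha>\<^esup>)\<^sub>m (q\<^bsup>\<eta>+\<gamma>-\<beta>\<^esup>)\<^sub>m)\<close>. On the points \<open>q\<^sup>n\<close> the q-Dirichlet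
  density is the case \<open>\<alpha> = \<beta> = 0\<close>. Integrating the triple series of Saran's function term by term
  therefore exchanges its parameters as claimed; absolute convergence holds because the
  coefficients are bounded and the moment weights are summable.
\<close>

section \<open>Unordered complex sums: products, differences and majorants\<close>

lemma has_sum_times_complex:
  fixes f :: "'a \<Rightarrow> complex" and g :: "'b \<Rightarrow> complex"
  assumes f: "(f has_sum a) A" and g: "(g has_sum b) B"
  shows "((\<lambda>(x, y). f x * g y) has_sum (a * b)) (A \<times> B)"
proof (rule has_sum_SigmaI)
  show "((\<lambda>y. case (x, y) of (x, y) \<Rightarrow> f x * g y) has_sum (f x * b)) B" for x
    using has_sum_cmult_right[OF g, of "f x"] by simp
  show "((\<lambda>x. f x * b) has_sum (a * b)) A"
    using has_sum_cmult_left[OF f] .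
  \<comment> \<open>Unordered summability of complex families is absolute, so the norms of the
    product family can be summed one variable at a time.\<close>
  have fa: "(\<lambda>x. norm (f x)) summable_on A" and ga: "(\<lambda>x. norm (g x)) summable_on B"
    using f g has_sum_imp_summable summable_on_iff_abs_summable_on_complex by blast+
  have "(\<lambda>p. norm (case p of (x, y) \<Rightarrow> f x * g y)) summable_on A \<times> B"
    using fa ga
    by (subst Infinite_Sum.abs_summable_on_Sigma_iff)
       (auto simp: norm_mult infsum_cmult_right' abs_mult infsum_nonneg intro!: summable_on_cmult_right summable_on_cmult_left)
  thus "(\<lambda>(x, y). f x * g y) summable_on A \<times> B"
    by (rule abs_summable_summable)
qed

lemma has_sum_diff_complex:
  fixes f g :: "'a \<Rightarrow> complex"
  assumes "(f has_sum a) A" "(g has_sum b) A"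
  shows "((\<lambda>x. f x - g x) has_sum (a - b)) A"
  using has_sum_add[OF assms(1) has_sum_cmult_right[OF assms(2), of "-1"]] by simp

lemma geometric_has_sum_complex:
  fixes r :: complex
  assumes "norm r < 1"
  shows "((\<lambda>n. r ^ n) has_sum (1 / (1 - r))) UNIV"
  using assms by (intro norm_summable_imp_has_sum geometric_sums) (auto simp: norm_power)

lemma summable_on_norm_bound_complex:
  fixes f g :: "'a \<Rightarrow> complex"
  assumes "g summable_on A" "\<And>x. x \<in> A \<Longrightarrow> norm (f x) \<le> M * norm (g x)"
  shows "f summable_on A"
proof -
  have M: "(\<lambda>x. norm (of_real M * g x)) summable_on A"
    using summable_on_cmult_right[OF assms(1)] by (simp only: flip: summable_on_iff_abs_summable_on_complex)
  have "norm (f x) \<le> norm (of_real M * g x)" if "x \<in> A" for x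
    using order.trans[OF assms(2)[OF that] mult_right_mono[OF abs_ge_self[of M] norm_ge_zero[of "g x"]]]
    unfolding norm_mult norm_of_real .
  hence "(\<lambda>x. norm (f x)) summable_on A"
    by (rule Infinite_Sum.abs_summable_on_comparison_test[OF M])
  thus ?thesis by (rule abs_summable_summable)
qed

lemma norm_mult_bound:
  fixes a b :: complex
  shows "norm a \<le> M \<Longrightarrow> norm b \<le> N \<Longrightarrow> norm (a * b) \<le> M * N"
  by (simp add: norm_mult mult_mono')

section \<open>Finite and infinite q-shifted factorials\<close>

lemma qpoch_0 [simp]: "qpoch a q 0 = 1"
  by (simp add: qpoch_def)

lemma qpoch_Suc: "qpoch a q (Suc n) = qpoch a q n * (1 - a * complex_of_real q ^ n)"
  by (simp add: qpoch_def)

lemma qpoch_add: "qpoch a q (m + n) = qpoch a q m * qpoch (a * complex_of_real q ^ m) q n"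
  by (induction n) (simp_all add: qpoch_Suc power_add algebra_simps)

lemma qpoch_one_eq_0: "n > 0 \<Longrightarrow> qpoch 1 q n = 0"
  by (auto simp: qpoch_def intro!: bexI[of _ 0])

lemma qpow_add: "0 < q \<Longrightarrow> qpow q (a + b) = qpow q a * qpow q b"
  by (simp add: qpow_def powr_add)

lemma qpow_diff: "0 < q \<Longrightarrow> qpow q (a - b) = qpow q a / qpow q b"
  by (simp add: qpow_def powr_diff)

lemma qpow_nonzero [simp]: "0 < q \<Longrightarrow> qpow q a \<noteq> 0"
  by (simp add: qpow_def)

lemma norm_qpow: "0 < q \<Longrightarrow> norm (qpow q a) = q powr Re a"
  by (simp add: qpow_def norm_powr_real_powr)

text \<open>Equivalent to all \<open>qpoch a q n\<close> being nonzero, that is, to \<open>a\<close>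
  being admissible as a denominator parameter. This single condition covers both
  \<open>norm a < 1\<close> and the exclusion of the values q^(-n).\<close>

definition qregular :: "real \<Rightarrow> complex \<Rightarrow> bool" where
  "qregular q a \<longleftrightarrow> (\<forall>n. a * complex_of_real q ^ n \<noteq> 1)"

lemma qregular_shift: "qregular q a \<Longrightarrow> qregular q (a * complex_of_real q ^ n)"
  unfolding qregular_def by (metis mult.assoc power_add)

lemma qpoch_nonzero: "qregular q a \<Longrightarrow> qpoch a q n \<noteq> 0"
  by (auto simp: qpoch_def qregular_def)

context
  fixes q :: real
  assumes q_pos: "0 < q" and q_less: "q < 1"
begin

lemma norm_qpow_less_1: "Re a > 0 \<Longrightarrow> norm (qpow q a) < 1"
  using q_pos q_less powr_less_mono2[of "Re a" q 1] by (simp add: norm_qpow)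

lemma qregular_norm_less_1:
  assumes "norm a < 1" shows "qregular q a"
  unfolding qregular_def
proof (intro allI notI)
  fix n assume "a * complex_of_real q ^ n = 1"
  hence "1 = norm a * q ^ n"
    using q_pos by (metis norm_mult norm_of_real norm_one norm_power abs_of_pos)
  moreover have "norm a * q ^ n \<le> norm a * 1"
    using q_pos q_less by (intro mult_left_mono power_le_one) auto
  ultimately show False using assms by simp
qed

lemma qregular_notin:
  assumes "a \<notin> {complex_of_real q powi (- int n) | n. True}"
  shows "qregular q a"
  unfolding qregular_def
proof (intro allI notI)
  fix n assume "a * complex_of_real q ^ n = 1"
  hence "a = complex_of_real q powi (- int n)"
    using q_pos by (simp add: power_int_minus field_simps)
  thus False using assms by blast
qed

lemma norm_power_q_mult_le: "norm (a * complex_of_real q ^ n) \<le> norm a"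
  using q_pos q_less by (simp add: norm_mult norm_power mult_left_le power_le_one)

lemma convergent_prod_qpoch: "convergent_prod (\<lambda>j. 1 - a * complex_of_real q ^ j)"
proof (rule abs_convergent_prod_imp_convergent_prod, subst abs_convergent_prod_conv_summable)
  have "summable (\<lambda>j. norm a * q ^ j)"
    using q_pos q_less by (intro summable_mult summable_geometric) auto
  thus "summable (\<lambda>j. norm (1 - a * complex_of_real q ^ j - 1))"
    using q_pos by (simp add: norm_mult norm_power)
qed

lemma qpoch_tendsto: "qpoch a q \<longlonglongrightarrow> qpoch_inf a q"
  using convergent_prod_LIMSEQ[OF convergent_prod_qpoch[of a]]
  unfolding qpoch_def qpoch_inf_def by (simp add: LIMSEQ_lessThan_iff_atMost)

lemma qpoch_inf_nonzero: "qregular q a \<Longrightarrow> qpoch_inf a q \<noteq> 0"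
  unfolding qpoch_inf_def qregular_def by (intro prodinf_nonzero convergent_prod_qpoch) auto

lemma qpoch_inf_split: "qpoch_inf a q = qpoch a q n * qpoch_inf (a * complex_of_real q ^ n) q"
proof (rule LIMSEQ_unique)
  show "(\<lambda>k. qpoch a q (n + k)) \<longlonglongrightarrow> qpoch_inf a q"
    using LIMSEQ_ignore_initial_segment[OF qpoch_tendsto, of a n] by (simp add: add.commute)
  show "(\<lambda>k. qpoch a q (n + k)) \<longlonglongrightarrow> qpoch a q n * qpoch_inf (a * complex_of_real q ^ n) q"
    unfolding qpoch_add by (intro tendsto_mult tendsto_const qpoch_tendsto)
qed

text \<open>A convergent sequence is bounded. Together with the bound for the inverses this reduces
  every convergence question below to a comparison with geometric series.\<close>

lemma qpoch_bounded: obtains M where "M > 0" "\<And>n. norm (qpoch a q n) \<le> M"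
  using convergent_imp_Bseq[OF convergentI[OF qpoch_tendsto]] BseqE by metis

text \<open>Regularity makes every factor, hence also the infinite product, nonzero, so the inverses
  converge too.\<close>

lemma inverse_qpoch_bounded:
  assumes "qregular q a"
  obtains M where "M > 0" "\<And>n. norm (inverse (qpoch a q n)) \<le> M"
  using convergent_imp_Bseq[OF convergentI[OF tendsto_inverse[OF qpoch_tendsto qpoch_inf_nonzero[OF assms]]]]
    BseqE by metis

lemma qregular_q: "qregular q (complex_of_real q)"
  using q_pos q_less by (intro qregular_norm_less_1) auto

subsection \<open>The q-binomial theorem and the q-Gauss sum\<close>

text \<open>Replacing \<open>z\<close> by \<open>z q\<close> in the q-binomial series \<open>\<Sum> u\<^sub>k\<close>, or \<open>c\<close> by \<open>c q\<close> in the q-Gauss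
  series, changes the sum by an explicit rational factor, because a suitable linear combination of
  the two summands telescopes with certificate \<open>(1 - q\<^sup>k) u\<^sub>k\<close>. Iterating drives the sum to its
  leading term \<open>1\<close>.\<close>

lemma q_telescope:
  fixes u :: "nat \<Rightarrow> complex"
  assumes u: "u summable_on UNIV"
  shows "((\<lambda>k. (1 - complex_of_real q ^ k) * u k
            - (1 - complex_of_real q ^ Suc k) * u (Suc k)) has_sum 0) UNIV"
proof -
  let ?s = "\<lambda>k. (1 - complex_of_real q ^ k) * u k"
  have "?s summable_on UNIV"
  proof (rule summable_on_norm_bound_complex[OF u])
    fix k
    have "norm (1 - complex_of_real q ^ k) \<le> 1 + norm (complex_of_real q ^ k)"
      using norm_triangle_ineq4[of 1 "complex_of_real q ^ k"] by simp
    also have "\<dots> \<le> 2"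
      using q_pos q_less by (simp add: norm_power power_le_one)
    finally show "norm (?s k) \<le> 2 * norm (u k)"
      by (simp add: norm_mult mult_right_mono)
  qed
  then obtain S where S: "(?s has_sum S) UNIV" using summable_on_def by blast
  have "((\<lambda>k. ?s (Suc k)) has_sum S) UNIV"
  proof -
    \<comment> \<open>The term at k = 0 contains 1 - q^0 = 0, so leaving it out does not change the
      sum.\<close>
    have "(?s has_sum S) (range Suc)"
      by (rule has_sum_cong_neutral[THEN iffD1, OF _ _ _ S])
         (auto simp: image_iff, metis not0_implies_Suc power_0)
    thus ?thesis by (subst (asm) has_sum_reindex) (auto simp: o_def)
  qed
  from has_sum_diff_complex[OF S this] show ?thesis by simp
qed

text \<open>For k > 0 the bound gains a factor (q^n)^k, which is at most q^n. Hence everything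
  beyond the leading term 1 is at most q^n times a fixed geometric sum.\<close>

lemma has_sum_tendsto_leading:
  fixes u :: "nat \<Rightarrow> nat \<Rightarrow> complex"
  assumes r: "norm r < 1"
    and bound: "\<And>n k. norm (u n k) \<le> M * norm (r * complex_of_real q ^ n) ^ k"
    and sum: "\<And>n. (u n has_sum S n) UNIV"
    and u0: "\<And>n. u n 0 = 1"
  shows "S \<longlonglongrightarrow> 1"
proof -
  have M: "M \<ge> 0"
    using bound[of 0 0] u0[of 0] by simp
  have geo: "((\<lambda>k. norm r ^ k) has_sum (1 / (1 - norm r))) UNIV"
    using r by (intro norm_summable_imp_has_sum geometric_sums) auto
  have le: "norm (S n - 1) \<le> q ^ n * (M * (1 / (1 - norm r)))" for n
  proof -
    have "((\<lambda>k. if k = 0 then 1 else 0 :: complex) has_sum 1) UNIV"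
      by (rule has_sum_cong_neutral[THEN iffD1, OF _ _ _ has_sum_finiteI[of "{0}"]]) auto
    from has_sum_diff_complex[OF sum this]
    have d: "((\<lambda>k. u n k - (if k = 0 then 1 else 0)) has_sum (S n - 1)) UNIV" .
    have "norm (u n k - (if k = 0 then 1 else 0)) \<le> q ^ n * (M * norm r ^ k)" for k
    proof (cases k)
      case 0
      thus ?thesis using u0 M q_pos by simp
    next
      case (Suc j)
      have "norm (u n k) \<le> M * (norm r ^ k * (q ^ n) ^ k)"
        using bound[of n k] q_pos by (simp add: norm_mult norm_power power_mult_distrib)
      also have "(q ^ n) ^ k \<le> q ^ n"
        using Suc q_pos q_less by (simp add: mult_left_le power_le_one)
      finally have "norm (u n k) \<le> M * (norm r ^ k * q ^ n)"
        using M by (simp add: mult_left_mono)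
      thus ?thesis using Suc by (simp add: mult_ac)
    qed
    thus ?thesis
      by (intro norm_infsum_le[OF d has_sum_cmult_right[OF has_sum_cmult_right[OF geo]]]) auto
  qed
  have "(\<lambda>n. q ^ n * (M * (1 / (1 - norm r)))) \<longlonglongrightarrow> 0"
    using q_pos q_less by (intro tendsto_mult_left_zero LIMSEQ_power_zero) auto
  hence "(\<lambda>n. S n - 1) \<longlonglongrightarrow> 0"
    by (rule Lim_null_comparison[OF always_eventually, rotated]) (use le in blast)
  thus ?thesis by (simp add: LIM_zero_iff)
qed

theorem q_binomial:
  assumes z: "norm z < 1"
  shows "((\<lambda>k. qpoch a q k / qpoch (complex_of_real q) q k * z ^ k) has_sum
           (qpoch_inf (a * z) q / qpoch_inf z q)) UNIV"
proof -
  let ?Q = "complex_of_real q"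
  \<comment> \<open>The index n counts how often z has been replaced by z q; the series wanted is
    \<open>u 0\<close>.\<close>
  define u where "u n k = qpoch a q k / qpoch ?Q q k * (z * ?Q ^ n) ^ k" for n k
  obtain Ma where Ma: "Ma > 0" "\<And>n. norm (qpoch a q n) \<le> Ma" using qpoch_bounded by metis
  obtain Mq where Mq: "Mq > 0" "\<And>n. norm (inverse (qpoch ?Q q n)) \<le> Mq"
    using inverse_qpoch_bounded[OF qregular_q] by metis
  have bound: "norm (u n k) \<le> Ma * Mq * norm (z * ?Q ^ n) ^ k" for n k
    unfolding u_def divide_inverse norm_mult[of "_ * _"] norm_mult[of "qpoch _ _ _"] norm_power[of _ k]
    using Ma Mq by (intro mult_right_mono mult_mono) (auto intro: less_imp_le)
  have zn: "norm (z * ?Q ^ n) < 1" for n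
    using norm_power_q_mult_le[of z n] z by linarith
  have usum: "u n summable_on UNIV" for n
    by (rule summable_on_norm_bound_complex[OF has_sum_imp_summable[OF geometric_has_sum_complex[OF zn[of n]]]])
       (use bound in \<open>simp add: norm_power\<close>)
  define S where "S n = infsum (u n) UNIV" for n
  have S: "(u n has_sum S n) UNIV" for n
    unfolding S_def using usum by (rule has_sum_infsum)
  have step: "(1 - z * ?Q ^ n) * S n = (1 - a * z * ?Q ^ n) * S (Suc n)" for n
  proof -
    have "((\<lambda>k. (1 - z * ?Q ^ n) * u n k - (1 - a * z * ?Q ^ n) * u (Suc n) k) has_sum
            ((1 - z * ?Q ^ n) * S n - (1 - a * z * ?Q ^ n) * S (Suc n))) UNIV"
      by (intro has_sum_diff_complex has_sum_cmult_right S)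
    moreover have "(1 - z * ?Q ^ n) * u n k - (1 - a * z * ?Q ^ n) * u (Suc n) k =
        (1 - ?Q ^ k) * u n k - (1 - ?Q ^ Suc k) * u n (Suc k)" for k
    proof -
      have nz: "1 - ?Q * ?Q ^ k \<noteq> 0" using qregular_q by (auto simp: qregular_def)
      have 1: "u (Suc n) k = ?Q ^ k * u n k"
        by (simp add: u_def power_mult_distrib)
      have 2: "(1 - ?Q ^ Suc k) * u n (Suc k) = (1 - a * ?Q ^ k) * (z * ?Q ^ n) * u n k"
        using nz by (simp add: u_def qpoch_Suc)
      show ?thesis unfolding 1 2 by (simp add: algebra_simps)
    qed
    ultimately have "(1 - z * ?Q ^ n) * S n - (1 - a * z * ?Q ^ n) * S (Suc n) = 0"
      by (intro has_sum_unique[OF _ q_telescope[OF usum[of n]]]) (simp only:)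
    thus ?thesis by simp
  qed
  \<comment> \<open>The contiguous relation iterated n times; the limit of both sides then gives
    \<open>S 0\<close>.\<close>
  have eq: "qpoch z q n * S 0 = qpoch (a * z) q n * S n" for n
  proof (induction n)
    case (Suc n)
    have "qpoch z q (Suc n) * S 0 = (1 - z * ?Q ^ n) * (qpoch z q n * S 0)"
      by (simp add: qpoch_Suc)
    also have "\<dots> = qpoch (a * z) q n * ((1 - z * ?Q ^ n) * S n)" by (simp add: Suc)
    finally show ?case by (simp add: step qpoch_Suc)
  qed simp
  have "S \<longlonglongrightarrow> 1"
    by (rule has_sum_tendsto_leading[OF z bound S]) (simp add: u_def)
  hence "(\<lambda>n. qpoch (a * z) q n * S n) \<longlonglongrightarrow> qpoch_inf (a * z) q * 1"
    by (intro tendsto_mult qpoch_tendsto)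
  moreover have "(\<lambda>n. qpoch z q n * S 0) \<longlonglongrightarrow> qpoch_inf z q * S 0"
    by (intro tendsto_mult qpoch_tendsto tendsto_const)
  ultimately have "qpoch_inf z q * S 0 = qpoch_inf (a * z) q"
    using LIMSEQ_unique by (simp add: eq)
  hence "S 0 = qpoch_inf (a * z) q / qpoch_inf z q"
    using qpoch_inf_nonzero[OF qregular_norm_less_1[OF z]] by (simp add: field_simps)
  thus ?thesis using S[of 0] by (simp add: u_def[abs_def])
qed

theorem q_gauss:
  assumes ab: "a \<noteq> 0" "b \<noteq> 0" and c: "qregular q c" and z: "norm (c / (a * b)) < 1"
  shows "((\<lambda>k. qpoch a q k * qpoch b q k / (qpoch (complex_of_real q) q k * qpoch c q k)
             * (c / (a * b)) ^ k) has_sum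
           (qpoch_inf (c / a) q * qpoch_inf (c / b) q
             / (qpoch_inf c q * qpoch_inf (c / (a * b)) q))) UNIV"
proof -
  let ?Q = "complex_of_real q"
  define Z where "Z = c / (a * b)"
  \<comment> \<open>Replacing c by c q^n also replaces the argument \<open>Z\<close> by Z
    q^n.\<close>
  define u where "u n k = qpoch a q k * qpoch b q k / (qpoch ?Q q k * qpoch (c * ?Q ^ n) q k)
    * (Z * ?Q ^ n) ^ k" for n k
  obtain Ma where Ma: "Ma > 0" "\<And>n. norm (qpoch a q n) \<le> Ma" using qpoch_bounded by metis
  obtain Mb where Mb: "Mb > 0" "\<And>n. norm (qpoch b q n) \<le> Mb" using qpoch_bounded by metis
  obtain Mq where Mq: "Mq > 0" "\<And>n. norm (inverse (qpoch ?Q q n)) \<le> Mq"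
    using inverse_qpoch_bounded[OF qregular_q] by metis
  obtain Mc where Mc: "Mc > 0" "\<And>n. norm (qpoch c q n) \<le> Mc" using qpoch_bounded by metis
  obtain Mi where Mi: "Mi > 0" "\<And>n. norm (inverse (qpoch c q n)) \<le> Mi"
    using inverse_qpoch_bounded[OF c] by metis
  \<comment> \<open>The denominator parameter varies with n. Writing its inverse factorial through
    factorials of the fixed c makes the bound uniform in n and k.\<close>
  have inv: "inverse (qpoch (c * ?Q ^ n) q k) = qpoch c q n * inverse (qpoch c q (n + k))" for n k
    using qpoch_nonzero[OF c] by (simp add: qpoch_add)
  have bound: "norm (u n k) \<le> Ma * Mb * (Mq * (Mc * Mi)) * norm (Z * ?Q ^ n) ^ k" for n k
    unfolding u_def divide_inverse inverse_mult_distrib inv norm_mult[of "_ * _ * (_ * (_ * _))"]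
      norm_mult[of "qpoch _ _ _"] norm_mult[of "qpoch _ _ _ * _"] norm_mult[of "inverse _"] norm_power[of _ k]
    using Ma Mb Mq Mc Mi by (intro mult_right_mono mult_mono) (auto intro: less_imp_le)
  have Z: "norm Z < 1" using z by (simp add: Z_def)
  have zn: "norm (Z * ?Q ^ n) < 1" for n
    using norm_power_q_mult_le[of Z n] Z by linarith
  have usum: "u n summable_on UNIV" for n
    by (rule summable_on_norm_bound_complex[OF has_sum_imp_summable[OF geometric_has_sum_complex[OF zn[of n]]]])
       (use bound in \<open>simp add: norm_power\<close>)
  define S where "S n = infsum (u n) UNIV" for n
  have S: "(u n has_sum S n) UNIV" for n
    unfolding S_def using usum by (rule has_sum_infsum)
  have step: "(1 - c * ?Q ^ n) * (1 - Z * ?Q ^ n) * S n =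
      (1 - c / a * ?Q ^ n) * (1 - c / b * ?Q ^ n) * S (Suc n)" for n
  proof -
    define d where "d = c * ?Q ^ n"
    have d: "qregular q d" unfolding d_def using c by (rule qregular_shift)
    have Zd: "Z * ?Q ^ n = d / (a * b)" and dn: "c * ?Q ^ Suc n = d * ?Q"
      by (simp_all add: Z_def d_def)
    have "((\<lambda>k. (1 - d / (a * b)) * u n k
              - (1 - d / a) * (1 - d / b) / (1 - d) * u (Suc n) k) has_sum
            ((1 - d / (a * b)) * S n - (1 - d / a) * (1 - d / b) / (1 - d) * S (Suc n))) UNIV"
      by (intro has_sum_diff_complex has_sum_cmult_right S)
    moreover have "(1 - d / (a * b)) * u n k - (1 - d / a) * (1 - d / b) / (1 - d) * u (Suc n) k =
        (1 - ?Q ^ k) * u n k - (1 - ?Q ^ Suc k) * u n (Suc k)" for k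
    proof -
      have nz: "1 - ?Q * ?Q ^ k \<noteq> 0" "1 - d * ?Q ^ k \<noteq> 0" "1 - d \<noteq> 0"
        using qregular_q d by (auto simp: qregular_def dest: spec[of _ 0])
      have "qpoch d q k * (1 - d * ?Q ^ k) = (1 - d) * qpoch (d * ?Q) q k"
        using qpoch_add[of d q 1 k] by (simp add: qpoch_def)
      hence sh: "qpoch (d * ?Q) q k = qpoch d q k * (1 - d * ?Q ^ k) / (1 - d)"
        using nz by (simp add: field_simps)
      have 1: "u (Suc n) k = ?Q ^ k * ((1 - d) / (1 - d * ?Q ^ k)) * u n k"
        unfolding u_def dn sh d_def[symmetric] by (simp add: power_mult_distrib mult_ac)
      have 2: "(1 - ?Q ^ Suc k) * u n (Suc k)
        = (1 - a * ?Q ^ k) * (1 - b * ?Q ^ k) / (1 - d * ?Q ^ k) * (d / (a * b)) * u n k"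
        using nz by (simp add: u_def qpoch_Suc mult_ac flip: Zd d_def)
      \<comment> \<open>By the two preceding facts every term is a rational multiple of
        \<open>u n k\<close>. Dividing by it leaves this rational identity in X = q^k, which
        verifies the telescoping certificate.\<close>
      have 3: "(1 - d / (a * b)) - (1 - d / a) * (1 - d / b) / (1 - d) * (X * ((1 - d) / (1 - d * X)))
        = (1 - X) - (1 - a * X) * (1 - b * X) / (1 - d * X) * (d / (a * b))"
        if "1 - d * X \<noteq> 0" for X
        using that nz(3) ab by (simp add: divide_simps) (simp add: algebra_simps)
      show ?thesis unfolding 1 2
        using arg_cong[OF 3[OF nz(2)], of "\<lambda>v. v * u n k"] by (simp add: left_diff_distrib mult.assoc)
    qed
    ultimately have
      "(1 - d / (a * b)) * S n - (1 - d / a) * (1 - d / b) / (1 - d) * S (Suc n) = 0"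
      by (intro has_sum_unique[OF _ q_telescope[OF usum[of n]]]) (simp only:)
    moreover have "1 - d \<noteq> 0" using d by (auto simp: qregular_def dest: spec[of _ 0])
    ultimately show ?thesis unfolding Zd d_def[symmetric] 
      by (simp add: field_simps d_def)
  qed
  have eq: "qpoch c q n * qpoch Z q n * S 0 = qpoch (c / a) q n * qpoch (c / b) q n * S n" for n
  proof (induction n)
    case (Suc n)
    have "qpoch c q (Suc n) * qpoch Z q (Suc n) * S 0 =
        (1 - c * ?Q ^ n) * (1 - Z * ?Q ^ n) * (qpoch c q n * qpoch Z q n * S 0)"
      by (simp add: qpoch_Suc)
    also have "\<dots> = qpoch (c / a) q n * qpoch (c / b) q n * ((1 - c * ?Q ^ n) * (1 - Z * ?Q ^ n) * S n)"
      by (simp add: Suc)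
    finally show ?case unfolding step by (simp add: qpoch_Suc)
  qed simp
  have "S \<longlonglongrightarrow> 1"
    by (rule has_sum_tendsto_leading[OF Z bound S]) (simp add: u_def)
  hence "(\<lambda>n. qpoch (c / a) q n * qpoch (c / b) q n * S n)
      \<longlonglongrightarrow> qpoch_inf (c / a) q * qpoch_inf (c / b) q * 1"
    by (intro tendsto_mult qpoch_tendsto)
  moreover have "(\<lambda>n. qpoch c q n * qpoch Z q n * S 0) \<longlonglongrightarrow> qpoch_inf c q * qpoch_inf Z q * S 0"
    by (intro tendsto_mult qpoch_tendsto tendsto_const)
  ultimately have "qpoch_inf c q * qpoch_inf Z q * S 0 = qpoch_inf (c / a) q * qpoch_inf (c / b) q"
    using LIMSEQ_unique by (simp add: eq)
  hence "S 0 = qpoch_inf (c / a) q * qpoch_inf (c / b) q / (qpoch_inf c q * qpoch_inf Z q)"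
    using qpoch_inf_nonzero[OF qregular_norm_less_1[OF Z]] qpoch_inf_nonzero[OF c]
    by (simp add: field_simps)
  thus ?thesis using S[of 0] by (simp add: u_def[abs_def] Z_def)
qed


subsection \<open>Moments of the q-hypergeometric measure\<close>

text \<open>With n = k + j the sum becomes a double series. The sum over j is a q-binomial series
  with value (c w q^k)_inf / (w)_inf. Splitting off the first k factors of (c w)_inf puts (c w)_k
  into the denominator, and the sum over k is a q-Gauss series with c replaced by c w.\<close>

lemma q_gauss_convolution:
  assumes ab: "a \<noteq> 0" "b \<noteq> 0" and c: "qregular q c" and w: "norm w < 1"
    and cw: "qregular q (c * w)" and z: "norm (c * w / (a * b)) < 1"
  shows "((\<lambda>n. \<Sum>k\<le>n. qpoch a q k * qpoch b q k * qpoch (c * complex_of_real q ^ k) q (n - k)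
              / (qpoch (complex_of_real q) q k * qpoch (complex_of_real q) q (n - k))
              * (c / (a * b)) ^ k * w ^ n) has_sum
           (qpoch_inf (c * w / a) q * qpoch_inf (c * w / b) q
             / (qpoch_inf w q * qpoch_inf (c * w / (a * b)) q))) UNIV"
proof -
  let ?Q = "complex_of_real q"
  define h where "h = (\<lambda>(k, j). qpoch a q k * qpoch b q k / qpoch ?Q q k * (c * w / (a * b)) ^ k
    * (qpoch (c * ?Q ^ k) q j / qpoch ?Q q j * w ^ j))"
  define V where "V = qpoch_inf (c * w / a) q * qpoch_inf (c * w / b) q
             / (qpoch_inf w q * qpoch_inf (c * w / (a * b)) q)"
  obtain Ma where Ma: "Ma > 0" "\<And>n. norm (qpoch a q n) \<le> Ma" using qpoch_bounded by metis
  obtain Mb where Mb: "Mb > 0" "\<And>n. norm (qpoch b q n) \<le> Mb" using qpoch_bounded by metis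
  obtain Mq where Mq: "Mq > 0" "\<And>n. norm (inverse (qpoch ?Q q n)) \<le> Mq"
    using inverse_qpoch_bounded[OF qregular_q] by metis
  obtain Mc where Mc: "Mc > 0" "\<And>n. norm (qpoch c q n) \<le> Mc" using qpoch_bounded by metis
  obtain Mi where Mi: "Mi > 0" "\<And>n. norm (inverse (qpoch c q n)) \<le> Mi"
    using inverse_qpoch_bounded[OF c] by metis
  \<comment> \<open>This removes the moving parameter c q^k, so that the coefficients are bounded
    uniformly in k and j and a product of two geometric series dominates.\<close>
  have shift: "qpoch (c * ?Q ^ k) q j = inverse (qpoch c q k) * qpoch c q (k + j)" for k j
    using qpoch_nonzero[OF c] by (simp add: qpoch_add)
  have hsum: "h summable_on UNIV \<times> UNIV"
  proof (rule summable_on_norm_bound_complex[OF has_sum_imp_summable[OF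
        has_sum_times_complex[OF geometric_has_sum_complex[OF z] geometric_has_sum_complex[OF w]]]])
    fix p :: "nat \<times> nat" 
    obtain k j where p: "p = (k, j)" by (cases p)
    have "h p = qpoch a q k * (qpoch b q k * (inverse (qpoch ?Q q k) * (inverse (qpoch c q k)
        * (qpoch c q (k + j) * (inverse (qpoch ?Q q j) * ((c * w / (a * b)) ^ k * w ^ j))))))"
      by (simp add: p h_def shift divide_inverse mult_ac)
    also have "norm \<dots> \<le> Ma * (Mb * (Mq * (Mi * (Mc * (Mq * norm ((c * w / (a * b)) ^ k * w ^ j))))))"
      using Ma Mb Mq Mc Mi by (intro norm_mult_bound) (auto intro: less_imp_le)
    finally show "norm (h p) \<le> Ma * Mb * Mq * Mi * Mc * Mq
        * norm (case p of (k, j) \<Rightarrow> (c * w / (a * b)) ^ k * w ^ j)"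
      by (simp add: p mult_ac)
  qed
  have "(h has_sum V) (UNIV \<times> UNIV)"
  proof (rule has_sum_SigmaI[OF _ _ hsum])
    fix k
    show "((\<lambda>j. h (k, j)) has_sum (qpoch a q k * qpoch b q k / qpoch ?Q q k * (c * w / (a * b)) ^ k
        * (qpoch_inf (c * ?Q ^ k * w) q / qpoch_inf w q))) UNIV"
      unfolding h_def prod.case by (intro has_sum_cmult_right q_binomial w)
  next
    have "qpoch a q k * qpoch b q k / qpoch ?Q q k * (c * w / (a * b)) ^ k
        * (qpoch_inf (c * ?Q ^ k * w) q / qpoch_inf w q)
      = qpoch_inf (c * w) q / qpoch_inf w q * (qpoch a q k * qpoch b q k
          / (qpoch ?Q q k * qpoch (c * w) q k) * (c * w / (a * b)) ^ k)" for k
      using qpoch_inf_split[of "c * w" k] qpoch_nonzero[OF cw, of k] by (simp add: mult_ac)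
    moreover have "V = qpoch_inf (c * w) q / qpoch_inf w q *
       (qpoch_inf (c * w / a) q * qpoch_inf (c * w / b) q
             / (qpoch_inf (c * w) q * qpoch_inf (c * w / (a * b)) q))"
      using qpoch_inf_nonzero[OF cw] by (simp add: V_def)
    ultimately show "((\<lambda>k. qpoch a q k * qpoch b q k / qpoch ?Q q k * (c * w / (a * b)) ^ k
        * (qpoch_inf (c * ?Q ^ k * w) q / qpoch_inf w q)) has_sum V) UNIV"
      using has_sum_cmult_right[OF q_gauss[OF ab cw z], of "qpoch_inf (c * w) q / qpoch_inf w q"]
      by (simp only:)
  qed
  \<comment> \<open>Regrouping along the diagonals k + j = n, each of which is finite.\<close>
  also have "?this \<longleftrightarrow> ((\<lambda>(n, k). h (k, n - k)) has_sum V) (SIGMA n:UNIV. {..n})"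
    by (rule has_sum_reindex_bij_witness[where i = "\<lambda>(n, k). (k, n - k)" and j = "\<lambda>(k, j). (k + j, k)"])
       auto
  finally have "((\<lambda>n. \<Sum>k\<le>n. h (k, n - k)) has_sum V) UNIV"
    by (rule has_sum_SigmaD) (auto intro: has_sum_finiteI)
  moreover have "h (k, n - k) = qpoch a q k * qpoch b q k * qpoch (c * ?Q ^ k) q (n - k)
              / (qpoch ?Q q k * qpoch ?Q q (n - k)) * (c / (a * b)) ^ k * w ^ n" if "k \<le> n" for n k
  proof -
    have "w ^ n = w ^ k * w ^ (n - k)" using that by (simp flip: power_add)
    thus ?thesis by (simp add: h_def power_mult_distrib power_divide mult_ac)
  qed
  ultimately show ?thesis by (simp add: V_def)
qed

text \<open>Each factor satisfies (1 - q^(j-n)) q^n = -q^j (1 - q^(n-j)). The powers q^j with j < k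
  collect to q^(k choose 2), and the remaining factors complete (q)_(n-k) to (q)_n.\<close>

lemma qpoch_inverse_power:
  assumes "k \<le> n"
  shows "qpoch (inverse (complex_of_real q ^ n)) q k * (complex_of_real q ^ n) ^ k
           * qpoch (complex_of_real q) q (n - k)
         = (-1) ^ k * complex_of_real q ^ (k choose 2) * qpoch (complex_of_real q) q n"
  using assms
proof (induction k)
  case (Suc k)
  let ?Q = "complex_of_real q"
  have Q: "?Q \<noteq> 0" using q_pos by simp
  obtain l where l: "n = k + Suc l" using Suc.prems by (metis add_Suc_right le_Suc_ex add_Suc)
  have f: "(1 - inverse (?Q ^ n) * ?Q ^ k) * ?Q ^ n = - (?Q ^ k * (1 - ?Q * ?Q ^ l))"
    using Q by (simp add: l power_add field_simps)
  have c: "Suc k choose 2 = (k choose 2) + k"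
    by (simp add: numeral_2_eq_2)
  have "qpoch (inverse (?Q ^ n)) q (Suc k) * (?Q ^ n) ^ Suc k * qpoch ?Q q (n - Suc k)
      = qpoch (inverse (?Q ^ n)) q k * (?Q ^ n) ^ k * qpoch ?Q q l
          * ((1 - inverse (?Q ^ n) * ?Q ^ k) * ?Q ^ n)"
    by (simp add: qpoch_Suc l)
  also have "\<dots> = - (?Q ^ k) * (qpoch (inverse (?Q ^ n)) q k * (?Q ^ n) ^ k * qpoch ?Q q (n - k))"
    unfolding f by (simp add: l qpoch_Suc)
  also have "\<dots> = - (?Q ^ k) * ((-1) ^ k * ?Q ^ (k choose 2) * qpoch ?Q q n)"
    using Suc by simp
  finally show ?case by (simp add: c power_add)
qed (simp add: binomial_eq_0)

text \<open>Here 1 + s - r = -1, so the sign and the power of q in the series cancel exactly those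
  from \<open>qpoch_inverse_power\<close>. The factor q^n is kept visible in the argument because it
  supplies the power q^(n k) needed there.\<close>

lemma basic_hyp_3_1_terminating:
  fixes a b c d :: complex
  shows "basic_hyp [a, b, inverse (complex_of_real q ^ n)] [c] q (complex_of_real q ^ n * d) =
    (\<Sum>k\<le>n. qpoch a q k * qpoch b q k / (qpoch c q k * qpoch (complex_of_real q) q k)
       * (qpoch (complex_of_real q) q n / qpoch (complex_of_real q) q (n - k)) * d ^ k)"
proof -
  let ?Q = "complex_of_real q"
  define t where "t k = qpochs [a, b, inverse (?Q ^ n)] q k / qpochs ([c] @ [?Q]) q k
          * ((-1) ^ k * ?Q ^ (k choose 2))
              powi (1 + int (length [c]) - int (length [a, b, inverse (?Q ^ n)]))
          * (?Q ^ n * d) ^ k" for k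
  have Q: "?Q \<noteq> 0" using q_pos by simp
  have "t k = 0" if "k \<notin> {..n}" for k
  proof -
    \<comment> \<open>For k > n the product contains the factor with index n, which is 1 - q^(-n)
      q^n = 0.\<close>
    have "qpoch (inverse (?Q ^ n)) q k = 0"
      unfolding qpoch_def using that Q by (intro prod_zero) (auto intro!: bexI[of _ n])
    thus ?thesis by (simp add: t_def qpochs_def)
  qed
  hence "suminf t = sum t {..n}" by (intro suminf_finite) auto
  moreover have "t k = qpoch a q k * qpoch b q k / (qpoch c q k * qpoch ?Q q k)
       * (qpoch ?Q q n / qpoch ?Q q (n - k)) * d ^ k" if "k \<le> n" for k
  proof -
    let ?s = "(-1) ^ k * ?Q ^ (k choose 2)"
    have s: "?s \<noteq> 0" using Q by simp
    have canc: "u = s * v \<Longrightarrow> s \<noteq> 0 \<Longrightarrow> u * inverse s = v" for s u v :: complex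
      by simp
    have "qpoch (inverse (?Q ^ n)) q k * (?Q ^ n) ^ k = ?s * (qpoch ?Q q n / qpoch ?Q q (n - k))"
      using qpoch_inverse_power[OF that] qpoch_nonzero[OF qregular_q, of "n - k"]
      by (simp add: nonzero_eq_divide_eq)
    hence e: "qpoch (inverse (?Q ^ n)) q k * (?Q ^ n) ^ k * inverse ?s = qpoch ?Q q n / qpoch ?Q q (n - k)"
      using s by (rule canc)
    have "t k = qpoch a q k * qpoch b q k / (qpoch c q k * qpoch ?Q q k)
       * (qpoch (inverse (?Q ^ n)) q k * (?Q ^ n) ^ k * inverse ?s) * d ^ k"
      by (simp add: t_def qpochs_def power_int_minus power_mult_distrib)
    thus ?thesis unfolding e .
  qed
  ultimately show ?thesis unfolding basic_hyp_def t_def[abs_def] by simp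
qed

text \<open>The extra q^n is the weight of the q-integral and turns t powr (\<eta> - 1) into the
  n-th power of \<open>qpow q \<eta>\<close>. The infinite products at t = q^n contribute
  (q^\<gamma>)_n / (q)_n. Here (q)_n cancels against the terminating series, and (q^\<gamma>)_n /
  (q^\<gamma>)_k is the shifted factorial of length n - k, which gives the summand of
  \<open>q_gauss_convolution\<close>.\<close>

lemma q_hypergeometric_density_power:
  assumes c: "qregular q (qpow q \<gamma>)"
  shows "q_hypergeometric_density \<alpha> \<beta> \<gamma> \<eta> q (q ^ n) * complex_of_real q ^ n =
    qGamma q (\<eta> + \<gamma> - \<alpha>) * qGamma q (\<eta> + \<gamma> - \<beta>)
       / (qGamma q \<eta> * qGamma q \<gamma> * qGamma q (\<eta> + \<gamma> - \<alpha> - \<beta>))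
     * (qpoch_inf (complex_of_real q) q / qpoch_inf (qpow q \<gamma>) q)
     * (\<Sum>k\<le>n. qpoch (qpow q \<alpha>) q k * qpoch (qpow q \<beta>) q k
              * qpoch (qpow q \<gamma> * complex_of_real q ^ k) q (n - k)
              / (qpoch (complex_of_real q) q k * qpoch (complex_of_real q) q (n - k))
              * (qpow q \<gamma> / (qpow q \<alpha> * qpow q \<beta>)) ^ k * qpow q \<eta> ^ n)"
proof -
  let ?Q = "complex_of_real q"
  define G where "G = qGamma q (\<eta> + \<gamma> - \<alpha>) * qGamma q (\<eta> + \<gamma> - \<beta>)
       / (qGamma q \<eta> * qGamma q \<gamma> * qGamma q (\<eta> + \<gamma> - \<alpha> - \<beta>))"
  have Q: "?Q \<noteq> 0" using q_pos by simp
  have p: "complex_of_real (q ^ n) powr (\<eta> - 1) * ?Q ^ n = qpow q \<eta> ^ n"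
  proof -
    have "complex_of_real (q ^ n) powr (\<eta> - 1) = (?Q powr (\<eta> - 1)) ^ n"
      using q_pos by (induction n) (simp_all add: powr_times_real)
    also have "?Q powr (\<eta> - 1) = qpow q \<eta> / ?Q"
      using Q by (simp add: qpow_def powr_diff)
    finally show ?thesis using Q by (simp add: power_divide)
  qed
  have 1: "qpoch_inf (complex_of_real (q ^ n * q)) q = qpoch_inf ?Q q / qpoch ?Q q n"
    using qpoch_inf_split[of ?Q n] qpoch_nonzero[OF qregular_q, of n] by (simp add: mult_ac)
  have 2: "qpoch_inf (complex_of_real (q ^ n) * qpow q \<gamma>) q
      = qpoch_inf (qpow q \<gamma>) q / qpoch (qpow q \<gamma>) q n"
    using qpoch_inf_split[of "qpow q \<gamma>" n] qpoch_nonzero[OF c, of n] by (simp add: mult_ac)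
  have 3: "basic_hyp [qpow q \<alpha>, qpow q \<beta>, complex_of_real (inverse (q ^ n))] [qpow q \<gamma>] q
         (complex_of_real (q ^ n) * qpow q (\<gamma> - \<alpha> - \<beta>)) =
     (\<Sum>k\<le>n. qpoch (qpow q \<alpha>) q k * qpoch (qpow q \<beta>) q k / (qpoch (qpow q \<gamma>) q k * qpoch ?Q q k)
       * (qpoch ?Q q n / qpoch ?Q q (n - k)) * (qpow q \<gamma> / (qpow q \<alpha> * qpow q \<beta>)) ^ k)"
    using basic_hyp_3_1_terminating[of "qpow q \<alpha>" "qpow q \<beta>" n "qpow q \<gamma>"
        "qpow q \<gamma> / (qpow q \<alpha> * qpow q \<beta>)"] q_pos
    by (simp add: qpow_diff)
  have 4: "qpoch (qpow q \<gamma>) q n = qpoch (qpow q \<gamma>) q k * qpoch (qpow q \<gamma> * ?Q ^ k) q (n - k)"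
    if "k \<le> n" for k
    using qpoch_add[of "qpow q \<gamma>" q k "n - k"] that by simp
  have "q_hypergeometric_density \<alpha> \<beta> \<gamma> \<eta> q (q ^ n) * ?Q ^ n =
     G * (qpoch_inf ?Q q / qpoch_inf (qpow q \<gamma>) q)
     * (\<Sum>k\<le>n. qpoch (qpow q \<gamma>) q n / qpoch ?Q q n * (qpoch (qpow q \<alpha>) q k * qpoch (qpow q \<beta>) q k
       / (qpoch (qpow q \<gamma>) q k * qpoch ?Q q k)
       * (qpoch ?Q q n / qpoch ?Q q (n - k)) * (qpow q \<gamma> / (qpow q \<alpha> * qpow q \<beta>)) ^ k)
       * (complex_of_real (q ^ n) powr (\<eta> - 1) * ?Q ^ n))"
    unfolding q_hypergeometric_density_def G_def[symmetric] 1 2 3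
      sum_distrib_left[symmetric] sum_distrib_right[symmetric]
    by (simp add: mult_ac)
  also have "\<dots> = G * (qpoch_inf ?Q q / qpoch_inf (qpow q \<gamma>) q)
     * (\<Sum>k\<le>n. qpoch (qpow q \<alpha>) q k * qpoch (qpow q \<beta>) q k
              * qpoch (qpow q \<gamma> * ?Q ^ k) q (n - k) / (qpoch ?Q q k * qpoch ?Q q (n - k))
              * (qpow q \<gamma> / (qpow q \<alpha> * qpow q \<beta>)) ^ k * qpow q \<eta> ^ n)"
    unfolding p
    using qpoch_nonzero[OF qregular_q] qpoch_nonzero[OF c]
    by (intro arg_cong[where f = "\<lambda>s. G * _ * s"], intro sum.cong refl) (simp add: 4)
  finally show ?thesis unfolding G_def .
qed

text \<open>Two q-Gamma functions stand over three, and their arguments have equal sums. So the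
  powers of 1 - q combine to exponent -1, and one (q)_inf survives in the denominator.\<close>

lemma qGamma_quotient:
  assumes "qregular q (qpow q \<eta>)" "qregular q (qpow q \<gamma>)" "qregular q (qpow q (\<eta> + \<gamma> - \<alpha> - \<beta>))"
    and "qregular q (qpow q (\<eta> + \<gamma> - \<alpha>))" "qregular q (qpow q (\<eta> + \<gamma> - \<beta>))"
  shows "qGamma q (\<eta> + \<gamma> - \<alpha>) * qGamma q (\<eta> + \<gamma> - \<beta>)
       / (qGamma q \<eta> * qGamma q \<gamma> * qGamma q (\<eta> + \<gamma> - \<alpha> - \<beta>)) =
    qpoch_inf (qpow q \<eta>) q * qpoch_inf (qpow q \<gamma>) q * qpoch_inf (qpow q (\<eta> + \<gamma> - \<alpha> - \<beta>)) q
      / (qpoch_inf (complex_of_real q) q * qpoch_inf (qpow q (\<eta> + \<gamma> - \<alpha>)) q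
          * qpoch_inf (qpow q (\<eta> + \<gamma> - \<beta>)) q * complex_of_real (1 - q))"
proof -
  define P where "P x = complex_of_real (1 - q) powr x" for x
  have nz: "complex_of_real (1 - q) \<noteq> 0" using q_less by (simp flip: of_real_diff)
  have P: "P x \<noteq> 0" "P (x + y) = P x * P y" "P 1 = complex_of_real (1 - q)" for x y
    using nz by (simp_all add: P_def powr_add)
  have "P (1 - \<eta>) * P (1 - \<gamma>) * P (1 - (\<eta> + \<gamma> - \<alpha> - \<beta>)) = P (1 - (\<eta> + \<gamma> - \<alpha>)) * P (1 - (\<eta> + \<gamma> - \<beta>)) * P 1"
    unfolding P(2)[symmetric] by (simp add: algebra_simps)
  hence e: "P (1 - (\<eta> + \<gamma> - \<alpha>)) * P (1 - (\<eta> + \<gamma> - \<beta>))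
      / (P (1 - \<eta>) * P (1 - \<gamma>) * P (1 - (\<eta> + \<gamma> - \<alpha> - \<beta>))) = 1 / complex_of_real (1 - q)"
    using P(1) nz by (simp add: P(3) divide_simps)
  have "qGamma q (\<eta> + \<gamma> - \<alpha>) * qGamma q (\<eta> + \<gamma> - \<beta>)
       / (qGamma q \<eta> * qGamma q \<gamma> * qGamma q (\<eta> + \<gamma> - \<alpha> - \<beta>)) =
    qpoch_inf (qpow q \<eta>) q * qpoch_inf (qpow q \<gamma>) q * qpoch_inf (qpow q (\<eta> + \<gamma> - \<alpha> - \<beta>)) q
      / (qpoch_inf (complex_of_real q) q * qpoch_inf (qpow q (\<eta> + \<gamma> - \<alpha>)) q
          * qpoch_inf (qpow q (\<eta> + \<gamma> - \<beta>)) q)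
    * (P (1 - (\<eta> + \<gamma> - \<alpha>)) * P (1 - (\<eta> + \<gamma> - \<beta>))
      / (P (1 - \<eta>) * P (1 - \<gamma>) * P (1 - (\<eta> + \<gamma> - \<alpha> - \<beta>))))"
    unfolding qGamma_def P_def[symmetric]
    using qpoch_inf_nonzero[OF qregular_q] by (simp add: mult_ac)
  thus ?thesis unfolding e by simp
qed

text \<open>The factor t^m only changes w = q^\<eta> into q^(\<eta> + m) in the convolution. The
  infinite products with and without this shift differ by finite factorials. The remaining 1 - q in
  the denominator offsets the prefactor of the q-integral, so the case m = 0 says that the measure
  has total mass 1.\<close>

theorem q_hypergeometric_moment:
  assumes "Re \<eta> > 0" "Re \<gamma> > 0" "Re (\<eta> + \<gamma> - \<alpha> - \<beta>) > 0"
    and X: "qregular q (qpow q (\<eta> + \<gamma> - \<alpha>))" and Y: "qregular q (qpow q (\<eta> + \<gamma> - \<beta>))"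
  shows "((\<lambda>n. q_hypergeometric_density \<alpha> \<beta> \<gamma> \<eta> q (q ^ n) * complex_of_real q ^ n
             * (complex_of_real q ^ n) ^ m) has_sum
    (qpoch (qpow q \<eta>) q m * qpoch (qpow q (\<eta> + \<gamma> - \<alpha> - \<beta>)) q m
      / (qpoch (qpow q (\<eta> + \<gamma> - \<alpha>)) q m * qpoch (qpow q (\<eta> + \<gamma> - \<beta>)) q m
          * complex_of_real (1 - q)))) UNIV"
proof -
  let ?Q = "complex_of_real q"
  define E where "E = qpow q \<eta>"
  define C where "C = qpow q \<gamma>"
  define A where "A = qpow q \<alpha>"
  define B where "B = qpow q \<beta>"
  have AB: "A \<noteq> 0" "B \<noteq> 0" using q_pos by (simp_all add: A_def B_def)
  have pw: "qpow q (\<eta> + \<gamma> - \<alpha>) = C * E / A" "qpow q (\<eta> + \<gamma> - \<beta>) = C * E / B"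
      "qpow q (\<eta> + \<gamma> - \<alpha> - \<beta>) = C * E / (A * B)"
    using q_pos by (simp_all add: qpow_diff qpow_add A_def B_def C_def E_def)
  have nE: "norm E < 1" and nC: "norm C < 1"
    using assms(1,2) norm_qpow_less_1 by (simp_all add: E_def C_def)
  have nD: "norm (C * E / (A * B)) < 1"
    using norm_qpow_less_1[OF assms(3)] unfolding pw(3) .
  note reg = nE[THEN qregular_norm_less_1] nC[THEN qregular_norm_less_1] nD[THEN qregular_norm_less_1]
  have rX: "qregular q (C * E / A)" and rY: "qregular q (C * E / B)"
    using X Y by (simp_all add: pw)
  define w where "w = E * ?Q ^ m"
  have nw: "norm w < 1" unfolding w_def using norm_power_q_mult_le[of E m] nE by linarith
  have sh: "C * w / v = C * E / v * ?Q ^ m" for v by (simp add: w_def)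
  have "norm (C * w) < 1" using mult_strict_mono'[OF nC nw] by (simp add: norm_mult)
  hence rCw: "qregular q (C * w)" by (rule qregular_norm_less_1)
  have nDw: "norm (C * w / (A * B)) < 1"
    unfolding sh using norm_power_q_mult_le[of "C * E / (A * B)" m] nD by linarith
  \<comment> \<open>All factors of the density that do not depend on n, with the q-Gamma functions
    already reduced.\<close>
  define K where "K = qpoch_inf E q * qpoch_inf (C * E / (A * B)) q
      / (qpoch_inf (C * E / A) q * qpoch_inf (C * E / B) q * complex_of_real (1 - q))"
  have sp: "qpoch_inf (v * ?Q ^ m) q = qpoch_inf v q / qpoch v q m" if "qregular q v" for v
    using qpoch_inf_split[of v m] qpoch_nonzero[OF that, of m] by (simp add: field_simps)
  have G: "qGamma q (\<eta> + \<gamma> - \<alpha>) * qGamma q (\<eta> + \<gamma> - \<beta>)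
       / (qGamma q \<eta> * qGamma q \<gamma> * qGamma q (\<eta> + \<gamma> - \<alpha> - \<beta>)) * (qpoch_inf ?Q q / qpoch_inf C q) = K"
    using reg rX rY qpoch_inf_nonzero[OF qregular_q] qpoch_inf_nonzero[OF reg(2)]
    by (subst qGamma_quotient)
       (simp_all add: pw K_def flip: E_def C_def)
  have dens: "q_hypergeometric_density \<alpha> \<beta> \<gamma> \<eta> q (q ^ n) * ?Q ^ n * (?Q ^ n) ^ m
     = K * (\<Sum>k\<le>n. qpoch A q k * qpoch B q k * qpoch (C * ?Q ^ k) q (n - k)
              / (qpoch ?Q q k * qpoch ?Q q (n - k)) * (C / (A * B)) ^ k * w ^ n)" for n
  proof -
    have "E ^ n * (?Q ^ n) ^ m = w ^ n"
      by (metis w_def power_mult_distrib power_mult mult.commute)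
    thus ?thesis
      unfolding q_hypergeometric_density_power[OF reg(2)[unfolded C_def]]
      unfolding E_def[symmetric] C_def[symmetric] A_def[symmetric] B_def[symmetric] G
      by (simp add: mult.assoc sum_distrib_right)
  qed
  have "K * (qpoch_inf (C * w / A) q * qpoch_inf (C * w / B) q
             / (qpoch_inf w q * qpoch_inf (C * w / (A * B)) q)) =
    qpoch E q m * qpoch (C * E / (A * B)) q m
      / (qpoch (C * E / A) q m * qpoch (C * E / B) q m * complex_of_real (1 - q))"
    unfolding sh unfolding w_def
    using sp[OF reg(1)] sp[OF reg(3)] sp[OF rX] sp[OF rY]
      qpoch_inf_nonzero[OF reg(1)] qpoch_inf_nonzero[OF reg(3)] qpoch_inf_nonzero[OF rX] qpoch_inf_nonzero[OF rY]
    by (simp add: K_def)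
  thus ?thesis
    unfolding dens pw E_def[symmetric]
    using has_sum_cmult_right[OF q_gauss_convolution[OF AB reg(2) nw rCw nDw], of K] by (simp only:)
qed

text \<open>Both numerator parameters are q^0 = 1, so only the term k = 0 of the series survives.
  The assumption makes \<open>qGamma q (\<alpha> + \<beta>)\<close> nonzero, which allows one copy
  of it to cancel.\<close>

lemma q_dirichlet_density_eq:
  assumes "Re (\<alpha> + \<beta>) > 0"
  shows "q_dirichlet_density \<alpha> \<beta> q (q ^ n) = q_hypergeometric_density 0 0 \<beta> \<alpha> q (q ^ n)"
proof -
  have "qpow q 0 = 1" using q_pos by (simp add: qpow_def)
  moreover have "(\<Sum>k\<le>n. f k) = f 0" if "\<And>k. k > 0 \<Longrightarrow> f k = 0" for f :: "nat \<Rightarrow> complex"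
    using that by (subst sum.mono_neutral_right[of _ "{0}"]) auto
  ultimately have "basic_hyp [qpow q 0, qpow q 0, complex_of_real (inverse (q ^ n))] [qpow q \<beta>] q
         (complex_of_real (q ^ n) * qpow q (\<beta> - 0 - 0)) = 1"
    using basic_hyp_3_1_terminating[of 1 1 n "qpow q \<beta>" "qpow q \<beta>"]
      qpoch_nonzero[OF qregular_q, of n] by (simp add: qpoch_one_eq_0)
  moreover have "qGamma q (\<alpha> + \<beta>) \<noteq> 0"
    using qpoch_inf_nonzero[OF qregular_q] q_less
      qpoch_inf_nonzero[OF qregular_norm_less_1[OF norm_qpow_less_1[OF assms]]]
    by (simp add: qGamma_def flip: of_real_diff)
  ultimately show ?thesis
    unfolding q_dirichlet_density_def q_hypergeometric_density_def by simp
qed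

subsection \<open>Termwise q-integration of Saran's function\<close>

definition saran_coeff ::
  "complex \<Rightarrow> complex \<Rightarrow> complex \<Rightarrow> complex \<Rightarrow> complex \<Rightarrow> complex \<Rightarrow> complex
     \<Rightarrow> nat \<Rightarrow> nat \<Rightarrow> nat \<Rightarrow> complex" where
  "saran_coeff a1 a2 b1 b2 c1 c2 c3 m n p =
     qpoch (qpow q a1) q m * qpoch (qpow q a2) q (n + p)
       * qpoch (qpow q b1) q (m + p) * qpoch (qpow q b2) q n
     / (qpochs [qpow q c1, complex_of_real q] q m
        * qpochs [qpow q c2, complex_of_real q] q n
        * qpochs [qpow q c3, complex_of_real q] q p)"

text \<open>All factorials and inverse factorials in the coefficient are bounded, so a triple
  geometric series dominates. Without summability the infinite sum in \<open>saran_K\<close> would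
  only be a default value.\<close>

lemma saran_coeff_has_sum:
  assumes c: "qregular q (qpow q c1)" "qregular q (qpow q c2)" "qregular q (qpow q c3)"
    and "norm x < 1" "norm y < 1" "norm z < 1"
  shows "((\<lambda>(m, n, p). saran_coeff a1 a2 b1 b2 c1 c2 c3 m n p * x ^ m * y ^ n * z ^ p) has_sum
           saran_K a1 a2 b1 b2 c1 c2 c3 q x y z) UNIV"
proof -
  let ?Q = "complex_of_real q"
  let ?f = "\<lambda>(m, n, p). saran_coeff a1 a2 b1 b2 c1 c2 c3 m n p * x ^ m * y ^ n * z ^ p"
  obtain Ma where Ma: "Ma > 0" "\<And>n. norm (qpoch (qpow q a1) q n) \<le> Ma" using qpoch_bounded by metis
  obtain Na where Na: "Na > 0" "\<And>n. norm (qpoch (qpow q a2) q n) \<le> Na" using qpoch_bounded by metis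
  obtain Mb where Mb: "Mb > 0" "\<And>n. norm (qpoch (qpow q b1) q n) \<le> Mb" using qpoch_bounded by metis
  obtain Nb where Nb: "Nb > 0" "\<And>n. norm (qpoch (qpow q b2) q n) \<le> Nb" using qpoch_bounded by metis
  obtain Mq where Mq: "Mq > 0" "\<And>n. norm (inverse (qpoch ?Q q n)) \<le> Mq"
    using inverse_qpoch_bounded[OF qregular_q] by metis
  obtain M1 where M1: "M1 > 0" "\<And>n. norm (inverse (qpoch (qpow q c1) q n)) \<le> M1"
    using inverse_qpoch_bounded[OF c(1)] by metis
  obtain M2 where M2: "M2 > 0" "\<And>n. norm (inverse (qpoch (qpow q c2) q n)) \<le> M2"
    using inverse_qpoch_bounded[OF c(2)] by metis
  obtain M3 where M3: "M3 > 0" "\<And>n. norm (inverse (qpoch (qpow q c3) q n)) \<le> M3"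
    using inverse_qpoch_bounded[OF c(3)] by metis
  have geo: "(\<lambda>(m, n, p). x ^ m * (case (n, p) of (n, p) \<Rightarrow> y ^ n * z ^ p)) summable_on UNIV \<times> UNIV \<times> UNIV"
    using has_sum_imp_summable[OF has_sum_times_complex[OF geometric_has_sum_complex[OF assms(4)]
        has_sum_times_complex[OF geometric_has_sum_complex[OF assms(5)] geometric_has_sum_complex[OF assms(6)]]]]
    by (simp add: case_prod_unfold)
  have "?f summable_on UNIV \<times> UNIV \<times> UNIV"
  proof (rule summable_on_norm_bound_complex[OF geo])
    fix v :: "nat \<times> nat \<times> nat"
    obtain m n p where v: "v = (m, n, p)" by (metis prod.exhaust)
    have "?f v = qpoch (qpow q a1) q m * (qpoch (qpow q a2) q (n + p) * (qpoch (qpow q b1) q (m + p)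
      * (qpoch (qpow q b2) q n * (inverse (qpoch (qpow q c1) q m) * (inverse (qpoch ?Q q m)
      * (inverse (qpoch (qpow q c2) q n) * (inverse (qpoch ?Q q n)
      * (inverse (qpoch (qpow q c3) q p) * (inverse (qpoch ?Q q p) * (x ^ m * (y ^ n * z ^ p)))))))))))"
      by (simp add: v saran_coeff_def qpochs_def divide_inverse mult_ac)
    also have "norm \<dots> \<le> Ma * (Na * (Mb * (Nb * (M1 * (Mq * (M2 * (Mq * (M3 * (Mq
        * norm (x ^ m * (y ^ n * z ^ p)))))))))))"
      using Ma Na Mb Nb Mq M1 M2 M3 by (intro norm_mult_bound) auto
    finally show "norm (?f v) \<le> Ma * Na * Mb * Nb * M1 * Mq * M2 * Mq * M3 * Mq
        * norm (case v of (m, n, p) \<Rightarrow> x ^ m * (case (n, p) of (n, p) \<Rightarrow> y ^ n * z ^ p))"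
      by (simp add: v mult_ac)
  qed
  hence "(?f has_sum infsum ?f UNIV) UNIV" by simp
  thus ?thesis unfolding saran_K_def saran_coeff_def .
qed

lemma has_sum_nat_vec3_iff:
  fixes f :: "nat \<times> nat \<times> nat \<Rightarrow> complex"
  shows "(f has_sum S) UNIV \<longleftrightarrow> ((\<lambda>n :: nat ^ 3. f (n $ 1, n $ 2, n $ 3)) has_sum S) UNIV"
  by (rule has_sum_reindex_bij_witness[where i = "\<lambda>n. (n $ 1, n $ 2, n $ 3)"
        and j = "\<lambda>(i, j, k). vector [i, j, k]"]) (auto simp: vec_eq_iff forall_3 vector_3)

text \<open>Passes from triples of exponents to the vector indices of the q-integral. Assuming
  \<open>has_sum\<close> yields integrability together with the value.\<close>

lemma q_integral_vec3:
  fixes F :: "real ^ 3 \<Rightarrow> complex"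
  assumes "((\<lambda>(i, j, k). F (vector [q ^ i, q ^ j, q ^ k])
      * (complex_of_real q ^ i * (complex_of_real q ^ j * complex_of_real q ^ k))) has_sum S) UNIV"
  shows "q_integrable q F" "q_integral q F = complex_of_real (1 - q) ^ 3 * S"
proof -
  have "(\<chi> i. q ^ (n $ i)) = (vector [q ^ (n $ 1), q ^ (n $ 2), q ^ (n $ 3)] :: real ^ 3)"
    for n :: "nat ^ 3"
    by (auto simp: vec_eq_iff forall_3 vector_3)
  hence "(q_integral_term q F has_sum S) UNIV"
    using assms unfolding has_sum_nat_vec3_iff q_integral_term_def[abs_def]
    by (simp add: sum_3 power_add mult.assoc)
  thus "q_integrable q F" "q_integral q F = complex_of_real (1 - q) ^ 3 * S"
    by (auto simp: q_integrable_def q_integral_def has_sum_imp_summable infsumI)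
qed

text \<open>Fubini for the series index (m, n, p) and the integration index (i, j, k). Summing over
  the latter first produces the moments, summing over the former first produces
  \<open>saran_K\<close> at the scaled arguments. Abstract weights treat both kinds of measure
  alike.\<close>

lemma saran_K_termwise_has_sum:
  fixes W1 W2 W3 \<mu>1 \<mu>2 \<mu>3 :: "nat \<Rightarrow> complex"
  assumes c: "qregular q (qpow q c1)" "qregular q (qpow q c2)" "qregular q (qpow q c3)"
    and xyz: "norm x < 1" "norm y < 1" "norm z < 1"
    and W1: "\<And>m. ((\<lambda>i. W1 i * (complex_of_real q ^ i) ^ m) has_sum \<mu>1 m) UNIV"
    and W2: "\<And>m. ((\<lambda>i. W2 i * (complex_of_real q ^ i) ^ m) has_sum \<mu>2 m) UNIV"
    and W3: "\<And>m. ((\<lambda>i. W3 i * (complex_of_real q ^ i) ^ m) has_sum \<mu>3 m) UNIV"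
    and S: "((\<lambda>(m, n, p). saran_coeff a1 a2 b1 b2 c1 c2 c3 m n p * x ^ m * y ^ n * z ^ p
              * (\<mu>1 m * (\<mu>2 n * \<mu>3 p))) has_sum S) UNIV"
  shows "((\<lambda>(i, j, k). saran_K a1 a2 b1 b2 c1 c2 c3 q (x * complex_of_real q ^ i)
            (y * complex_of_real q ^ j) (z * complex_of_real q ^ k)
            * (W1 i * (W2 j * W3 k))) has_sum S) UNIV"
proof -
  let ?Q = "complex_of_real q"
  define T where "T = (\<lambda>(m, n, p). saran_coeff a1 a2 b1 b2 c1 c2 c3 m n p * x ^ m * y ^ n * z ^ p)"
  define V where "V = (\<lambda>(i, j, k). W1 i * (W2 j * W3 k))"
  define X where "X = (\<lambda>(m, n, p) (i, j, k). (?Q ^ i) ^ m * ((?Q ^ j) ^ n * (?Q ^ k) ^ p))"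
  have T: "(T has_sum saran_K a1 a2 b1 b2 c1 c2 c3 q x y z) UNIV"
    unfolding T_def by (rule saran_coeff_has_sum[OF c xyz])
  \<comment> \<open>The zeroth moments already give absolute summability of the weights. Since
    \<open>X\<close> has norm at most 1, the product of \<open>T\<close> and \<open>V\<close> then
    dominates the whole double family.\<close>
  have V: "(V has_sum (\<mu>1 0 * (\<mu>2 0 * \<mu>3 0))) UNIV"
    using has_sum_times_complex[OF W1[of 0] has_sum_times_complex[OF W2[of 0] W3[of 0]]]
    by (simp add: V_def case_prod_unfold)
  have X: "norm (X u v) \<le> 1" for u v
    using q_pos q_less
    by (auto simp: X_def norm_mult norm_power intro!: mult_le_one power_le_one split: prod.split)
  have sum: "(\<lambda>(u, v). T u * (X u v * V v)) summable_on UNIV \<times> UNIV"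
  proof (rule summable_on_norm_bound_complex[OF has_sum_imp_summable[OF has_sum_times_complex[OF T V]]])
    fix w :: "(nat \<times> nat \<times> nat) \<times> nat \<times> nat \<times> nat"
    obtain u v where w: "w = (u, v)" by (cases w)
    have "norm (T u * (X u v * V v)) = norm (X u v) * norm (T u * V v)"
      by (simp add: norm_mult)
    also have "\<dots> \<le> 1 * norm (T u * V v)"
      using X by (intro mult_right_mono) auto
    finally show "norm (case w of (u, v) \<Rightarrow> T u * (X u v * V v))
        \<le> 1 * norm (case w of (u, v) \<Rightarrow> T u * V v)"
      by (simp add: w)
  qed
  have "((\<lambda>(u, v). T u * (X u v * V v)) has_sum S) (UNIV \<times> UNIV)"
  proof (rule has_sum_SigmaI[OF _ _ sum])
    fix u :: "nat \<times> nat \<times> nat"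
    obtain m n p where u: "u = (m, n, p)" by (metis prod.exhaust)
    have "((\<lambda>(i, j, k). W1 i * (?Q ^ i) ^ m * (W2 j * (?Q ^ j) ^ n * (W3 k * (?Q ^ k) ^ p))) has_sum
        (\<mu>1 m * (\<mu>2 n * \<mu>3 p))) UNIV"
      using has_sum_times_complex[OF W1[of m] has_sum_times_complex[OF W2[of n] W3[of p]]]
      by (simp add: case_prod_unfold)
    from has_sum_cmult_right[OF this, of "T u"]
    show "((\<lambda>v. case (u, v) of (u, v) \<Rightarrow> T u * (X u v * V v)) has_sum
        (case u of (m, n, p) \<Rightarrow> T u * (\<mu>1 m * (\<mu>2 n * \<mu>3 p)))) UNIV"
      by (simp add: u X_def V_def case_prod_unfold mult_ac)
  next
    show "((\<lambda>u. case u of (m, n, p) \<Rightarrow> T u * (\<mu>1 m * (\<mu>2 n * \<mu>3 p))) has_sum S) UNIV"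
      using S by (simp add: T_def case_prod_unfold)
  qed
  hence "((\<lambda>(v, u). T u * (X u v * V v)) has_sum S) (UNIV \<times> UNIV)"
    by (subst (asm) has_sum_swap) (simp add: case_prod_unfold)
  thus ?thesis
  proof (rule has_sum_SigmaD)
    fix v :: "nat \<times> nat \<times> nat"
    obtain i j k where v: "v = (i, j, k)" by (metis prod.exhaust)
    have "norm (x * ?Q ^ i) < 1" "norm (y * ?Q ^ j) < 1" "norm (z * ?Q ^ k) < 1"
      using norm_power_q_mult_le[of x i] norm_power_q_mult_le[of y j] norm_power_q_mult_le[of z k] xyz
      by linarith+
    from has_sum_cmult_left[OF saran_coeff_has_sum[OF c this], of _ _ _ _ "V v"]
    show "((\<lambda>u. case (v, u) of (v, u) \<Rightarrow> T u * (X u v * V v)) has_sum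
       (case v of (i, j, k) \<Rightarrow> saran_K a1 a2 b1 b2 c1 c2 c3 q (x * ?Q ^ i) (y * ?Q ^ j) (z * ?Q ^ k)
            * (W1 i * (W2 j * W3 k)))) UNIV"
      by (simp add: v X_def V_def T_def case_prod_unfold power_mult_distrib mult_ac)
  qed
qed

end

section \<open>Exchange of parameters in Saran's function\<close>

theorem corollary4p5:
  fixes q :: real
    and x y z \<alpha>\<^sub>1 \<alpha>\<^sub>2 \<beta>\<^sub>1 \<beta>\<^sub>2 \<gamma>\<^sub>1 \<gamma>\<^sub>2 \<gamma>\<^sub>3 \<eta>\<^sub>1 \<eta>\<^sub>2 \<nu>\<^sub>1 \<nu>\<^sub>2 \<nu>\<^sub>3 :: complex
  assumes "0 < q" "q < 1"
    and "norm x < 1" "norm y < 1" "norm z < 1"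
    and "Min {Re (\<gamma>\<^sub>1 + \<eta>\<^sub>1 - \<alpha>\<^sub>1 - \<nu>\<^sub>1), Re \<alpha>\<^sub>1, Re \<nu>\<^sub>1} > 0"
    and "Min {Re (\<gamma>\<^sub>2 + \<eta>\<^sub>2 - \<beta>\<^sub>2 - \<nu>\<^sub>2), Re \<beta>\<^sub>2, Re \<nu>\<^sub>2} > 0"
    and "Re \<gamma>\<^sub>3 > Re \<nu>\<^sub>3" "Re \<nu>\<^sub>3 > 0"
    and "qpow q \<gamma>\<^sub>1 \<notin> {complex_of_real q powi (- int n) | n. True}"
    and "qpow q \<gamma>\<^sub>2 \<notin> {complex_of_real q powi (- int n) | n. True}"
    and "qpow q \<eta>\<^sub>1 \<notin> {complex_of_real q powi (- int n) | n. True}"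
    and "qpow q \<eta>\<^sub>2 \<notin> {complex_of_real q powi (- int n) | n. True}"
  shows
    "let F = (\<lambda>t :: real ^ 3.
        saran_K \<eta>\<^sub>1 \<alpha>\<^sub>2 \<beta>\<^sub>1 \<eta>\<^sub>2 \<nu>\<^sub>1 \<nu>\<^sub>2 \<nu>\<^sub>3 q
          (x * complex_of_real (t $ 1)) (y * complex_of_real (t $ 2)) (z * complex_of_real (t $ 3))
        * q_hypergeometric_density (\<eta>\<^sub>1 - \<alpha>\<^sub>1) (\<gamma>\<^sub>1 - \<alpha>\<^sub>1) (\<gamma>\<^sub>1 - \<alpha>\<^sub>1 + \<eta>\<^sub>1 - \<nu>\<^sub>1) \<nu>\<^sub>1 q (t $ 1)
        * q_hypergeometric_density (\<eta>\<^sub>2 - \<beta>\<^sub>2) (\<gamma>\<^sub>2 - \<beta>\<^sub>2) (\<gamma>\<^sub>2 - \<beta>\<^sub>2 + \<eta>\<^sub>2 - \<nu>\<^sub>2) \<nu>\<^sub>2 q (t $ 2)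
        * q_dirichlet_density \<nu>\<^sub>3 (\<gamma>\<^sub>3 - \<nu>\<^sub>3) q (t $ 3))
     in q_integrable q F \<and>
        saran_K \<alpha>\<^sub>1 \<alpha>\<^sub>2 \<beta>\<^sub>1 \<beta>\<^sub>2 \<gamma>\<^sub>1 \<gamma>\<^sub>2 \<gamma>\<^sub>3 q x y z = q_integral q F"
proof -
  let ?Q = "complex_of_real q" and ?R = "complex_of_real (1 - q)"
  note q = assms(1,2)
  have re: "Re (\<gamma>\<^sub>1 + \<eta>\<^sub>1 - \<alpha>\<^sub>1 - \<nu>\<^sub>1) > 0" "Re \<alpha>\<^sub>1 > 0" "Re \<nu>\<^sub>1 > 0"
      "Re (\<gamma>\<^sub>2 + \<eta>\<^sub>2 - \<beta>\<^sub>2 - \<nu>\<^sub>2) > 0" "Re \<beta>\<^sub>2 > 0" "Re \<nu>\<^sub>2 > 0"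
    using assms(6,7) by simp_all
  note regular = assms(10-13)[THEN qregular_notin[OF q]]
  have regular_pos: "qregular q (qpow q a)" if "Re a > 0" for a
    using that by (intro qregular_norm_less_1[OF q] norm_qpow_less_1[OF q])
  define W1 where "W1 i = q_hypergeometric_density (\<eta>\<^sub>1 - \<alpha>\<^sub>1) (\<gamma>\<^sub>1 - \<alpha>\<^sub>1)
    (\<gamma>\<^sub>1 - \<alpha>\<^sub>1 + \<eta>\<^sub>1 - \<nu>\<^sub>1) \<nu>\<^sub>1 q (q ^ i) * ?Q ^ i" for i
  define W2 where "W2 i = q_hypergeometric_density (\<eta>\<^sub>2 - \<beta>\<^sub>2) (\<gamma>\<^sub>2 - \<beta>\<^sub>2)
    (\<gamma>\<^sub>2 - \<beta>\<^sub>2 + \<eta>\<^sub>2 - \<nu>\<^sub>2) \<nu>\<^sub>2 q (q ^ i) * ?Q ^ i" for i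
  define W3 where "W3 i = q_dirichlet_density \<nu>\<^sub>3 (\<gamma>\<^sub>3 - \<nu>\<^sub>3) q (q ^ i) * ?Q ^ i" for i
  \<comment> \<open>The measure's parameters are chosen so that, in the moment formula,
    \<open>\<eta> + \<gamma> - \<alpha>\<close>, \<open>\<eta> + \<gamma> - \<beta>\<close> and
    \<open>\<eta> + \<gamma> - \<alpha> - \<beta>\<close> become \<open>\<gamma>\<^sub>1\<close>,
    \<open>\<eta>\<^sub>1\<close> and \<open>\<alpha>\<^sub>1\<close>; similarly for the second
    variable.\<close>
  define \<mu>1 where "\<mu>1 m = qpoch (qpow q \<nu>\<^sub>1) q m * qpoch (qpow q \<alpha>\<^sub>1) q m
    / (qpoch (qpow q \<gamma>\<^sub>1) q m * qpoch (qpow q \<eta>\<^sub>1) q m * ?R)" for m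
  define \<mu>2 where "\<mu>2 m = qpoch (qpow q \<nu>\<^sub>2) q m * qpoch (qpow q \<beta>\<^sub>2) q m
    / (qpoch (qpow q \<gamma>\<^sub>2) q m * qpoch (qpow q \<eta>\<^sub>2) q m * ?R)" for m
  define \<mu>3 where "\<mu>3 m = qpoch (qpow q \<nu>\<^sub>3) q m / (qpoch (qpow q \<gamma>\<^sub>3) q m * ?R)" for m
  have re3: "Re \<gamma>\<^sub>3 > 0" using assms(8,9) by simp
  have W1: "((\<lambda>i. W1 i * (?Q ^ i) ^ m) has_sum \<mu>1 m) UNIV" for m
    using q_hypergeometric_moment[OF q, of \<nu>\<^sub>1 "\<gamma>\<^sub>1 - \<alpha>\<^sub>1 + \<eta>\<^sub>1 - \<nu>\<^sub>1" "\<eta>\<^sub>1 - \<alpha>\<^sub>1" "\<gamma>\<^sub>1 - \<alpha>\<^sub>1" m] re regular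
    by (simp add: W1_def \<mu>1_def)
  have W2: "((\<lambda>i. W2 i * (?Q ^ i) ^ m) has_sum \<mu>2 m) UNIV" for m
    using q_hypergeometric_moment[OF q, of \<nu>\<^sub>2 "\<gamma>\<^sub>2 - \<beta>\<^sub>2 + \<eta>\<^sub>2 - \<nu>\<^sub>2" "\<eta>\<^sub>2 - \<beta>\<^sub>2" "\<gamma>\<^sub>2 - \<beta>\<^sub>2" m] re regular
    by (simp add: W2_def \<mu>2_def)
  \<comment> \<open>With both numerator parameters zero, the moment formula contains the factorial
    of \<open>qpow q \<gamma>\<^sub>3\<close> once above and twice below; one copy cancels.\<close>
  have W3: "((\<lambda>i. W3 i * (?Q ^ i) ^ m) has_sum \<mu>3 m) UNIV" for m
    using q_hypergeometric_moment[OF q, of \<nu>\<^sub>3 "\<gamma>\<^sub>3 - \<nu>\<^sub>3" 0 0 m] assms(8,9) regular_pos[OF re3]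
      qpoch_nonzero[OF regular_pos[OF re3], of m]
    by (simp add: W3_def \<mu>3_def q_dirichlet_density_eq[OF q])
  have R: "?R \<noteq> 0" using q by (simp flip: of_real_diff)
  \<comment> \<open>The first two moments trade \<open>\<eta>\<^sub>1\<close>,
    \<open>\<nu>\<^sub>1\<close> for \<open>\<alpha>\<^sub>1\<close>,
    \<open>\<gamma>\<^sub>1\<close> and \<open>\<eta>\<^sub>2\<close>, \<open>\<nu>\<^sub>2\<close>
    for \<open>\<beta>\<^sub>2\<close>, \<open>\<gamma>\<^sub>2\<close>; the third trades
    \<open>\<nu>\<^sub>3\<close> for \<open>\<gamma>\<^sub>3\<close>. Each leaves a factor 1 / (1 -
    q), and these three cancel the prefactor of the q-integral at the end.\<close>
  have coeff: "saran_coeff q \<eta>\<^sub>1 \<alpha>\<^sub>2 \<beta>\<^sub>1 \<eta>\<^sub>2 \<nu>\<^sub>1 \<nu>\<^sub>2 \<nu>\<^sub>3 m n p * x ^ m * y ^ n * z ^ p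
      * (\<mu>1 m * (\<mu>2 n * \<mu>3 p))
    = saran_coeff q \<alpha>\<^sub>1 \<alpha>\<^sub>2 \<beta>\<^sub>1 \<beta>\<^sub>2 \<gamma>\<^sub>1 \<gamma>\<^sub>2 \<gamma>\<^sub>3 m n p * x ^ m * y ^ n * z ^ p * (1 / ?R ^ 3)" for m n p
    using qpoch_nonzero[OF regular(3), of m] qpoch_nonzero[OF regular(4), of n]
      qpoch_nonzero[OF regular_pos[OF re(3)], of m] qpoch_nonzero[OF regular_pos[OF re(6)], of n]
      qpoch_nonzero[OF regular_pos[OF assms(9)], of p]
    unfolding saran_coeff_def[OF q] qpochs_def \<mu>1_def \<mu>2_def \<mu>3_def power3_eq_cube
    by (simp del: of_real_diff add: mult_ac)
  define S where "S = saran_K \<alpha>\<^sub>1 \<alpha>\<^sub>2 \<beta>\<^sub>1 \<beta>\<^sub>2 \<gamma>\<^sub>1 \<gamma>\<^sub>2 \<gamma>\<^sub>3 q x y z * (1 / ?R ^ 3)"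
  have "((\<lambda>(m, n, p). saran_coeff q \<eta>\<^sub>1 \<alpha>\<^sub>2 \<beta>\<^sub>1 \<eta>\<^sub>2 \<nu>\<^sub>1 \<nu>\<^sub>2 \<nu>\<^sub>3 m n p * x ^ m * y ^ n * z ^ p
      * (\<mu>1 m * (\<mu>2 n * \<mu>3 p))) has_sum S) UNIV"
    using has_sum_cmult_left[OF saran_coeff_has_sum[OF q regular(1,2) regular_pos[OF re3] assms(3-5)],
      of _ _ _ _ "1 / ?R ^ 3"]
    unfolding coeff S_def by (simp add: case_prod_unfold)
  from saran_K_termwise_has_sum[OF q regular_pos[OF re(3)] regular_pos[OF re(6)] regular_pos[OF assms(9)]
      assms(3-5) W1 W2 W3 this]
  have sum: "((\<lambda>(i, j, k). saran_K \<eta>\<^sub>1 \<alpha>\<^sub>2 \<beta>\<^sub>1 \<eta>\<^sub>2 \<nu>\<^sub>1 \<nu>\<^sub>2 \<nu>\<^sub>3 q (x * ?Q ^ i) (y * ?Q ^ j) (z * ?Q ^ k)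
            * (W1 i * (W2 j * W3 k))) has_sum S) UNIV" .
  have "saran_K \<alpha>\<^sub>1 \<alpha>\<^sub>2 \<beta>\<^sub>1 \<beta>\<^sub>2 \<gamma>\<^sub>1 \<gamma>\<^sub>2 \<gamma>\<^sub>3 q x y z = ?R ^ 3 * S"
    using R by (simp add: S_def)
  thus ?thesis
    unfolding Let_def
    using q_integral_vec3[OF q, where S = S] sum
    by (simp add: vector_3 W1_def W2_def W3_def mult_ac case_prod_unfold)
qed

end
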